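(* Let $0<q<1$, $N\ge1$ and $A,B,C\in\mathrm{End}(\mathbb{C}^N)$. Assume that $A$ and $B$ are diagonalizable with non-zero eigenvalues and that the following genericity conditions on the spectra hold: $$\sigma(A)\cap\sigma(B)=\emptyset,\quad \sigma(A)\cap\sigma(B)q^{1+\mathbb{N}}=\emptyset,\quad \sigma(B)\cap\sigma(B)q^{1+\mathbb{N}}=\emptyset .$$ Let $\sigma(A)=\{a_1,\dots,a_N\}$, $\sigma(B)=\{b_1,\dots,b_N\}$, with corresponding bases of eigenvectors $Af_i^A=a_if_i^A$, $Bf_i^B=b_if_i^B$ ($1\le i\le N$). Then, assuming that all inverse matrices occurring in the series $\Theta$ below exist, $$z^{-\log_q(b_i)}\,\Theta^{qb_i}(B,A;C;q,qz^{-1})\,f_i^B,\qquad 1\le i\le N,$$ $$z^{-\log_q(a_i)}\,\Theta^{qa_i}(B,A;C;q,qz^{-1})\,(a_i-B)^{-1}f_i^A,\qquad 1\le i\le N,$$ are linearly independent solutions of the vector-valued basic hypergeometric $q$-difference equation $$(q-z)f(q^{-1}z)+\bigl((A+B)z-C-q\,\mathrm{Id}\bigr)f(z)+(C-ABz)f(qz)=0 .$$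
   Context: $\sigma(M)$ denotes the set of eigenvalues of a matrix $M$; $\mathbb{N}=\{0,1,2,\dots\}$; $\sigma(M)q^{1+\mathbb{N}}=\{mq^{1+k}: m\in\sigma(M),k\in\mathbb{N}\}$; $(x;q)_n=\prod_{k=0}^{n-1}(1-xq^k)$. Scalars are identified with multiples of the identity matrix. The unknown $f$ in the equation is a $\mathbb{C}^N$-valued function. For matrices $A,B,C$ and a scalar $\alpha$ put $[A,B;C;\alpha;q]_0=\mathrm{Id}$ and $$[A,B;C;\alpha;q]_n=m_{n-1}m_{n-2}\cdots m_0,\qquad m_k=(A-\alpha q^k)^{-1}(B-\alpha q^k)^{-1}(C-\alpha q^k),$$ where it is assumed that all inverses of the matrices involved exist, and $$\Theta^{\alpha}(A,B;C;q,z)=\sum_{n=0}^\infty(\alpha/q;q)_n\,[A,B;C;\alpha;q]_n\,z^n .$$ (In the claim, the roles of $A$ and $B$ in $\Theta$ are interchanged.) The solutions are power series solutions at $z=\infty$. $\log_q(x)=\log x/\log q$ for a fixed choice of logarithm, and $z^s$ is defined with the principal branch, so that $(qz)^s=q^sz^s$. *)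

theory Defs
  imports "HOL-Analysis.Analysis"
begin

text \<open>Endomorphisms of the \<open>N\<close>-dimensional space are matrices \<open>complex^'n^'n\<close> with
  \<open>N = CARD('n)\<close>; a scalar \<open>c\<close> regarded as a matrix is \<open>mat c\<close>.\<close>

definition spectrum :: "complex^'n^'n \<Rightarrow> complex set" where
  "spectrum M = {m. \<exists>v. v \<noteq> 0 \<and> M *v v = m *s v}"

definition qshifts :: "real \<Rightarrow> complex set \<Rightarrow> complex set" where
  "qshifts q S = {m * of_real q ^ (1 + k) | m k. m \<in> S}"

text \<open>A matrix is diagonalizable iff it has an eigenbasis. Eigenvalues are listed with
  multiplicity, so the \<open>m i\<close> need not be distinct.\<close>

definition eigenbasis :: "complex^'n^'n \<Rightarrow> ('n \<Rightarrow> complex) \<Rightarrow> ('n \<Rightarrow> complex^'n) \<Rightarrow> bool" where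
  "eigenbasis M m v \<longleftrightarrow>
     inj v \<and> vec.independent (range v) \<and> vec.span (range v) = UNIV \<and>
     (\<forall>i. M *v v i = m i *s v i)"

definition qpochhammer :: "complex \<Rightarrow> real \<Rightarrow> nat \<Rightarrow> complex" where
  "qpochhammer x q n = (\<Prod>k<n. 1 - x * of_real q ^ k)"

primrec qbracket :: "complex^'n^'n \<Rightarrow> complex^'n^'n \<Rightarrow> complex^'n^'n \<Rightarrow> complex \<Rightarrow> real \<Rightarrow> nat
    \<Rightarrow> complex^'n^'n" where
  "qbracket A B C \<alpha> q 0 = mat 1"
| "qbracket A B C \<alpha> q (Suc n) =
     (matrix_inv (A - mat (\<alpha> * of_real q ^ n)) ** matrix_inv (B - mat (\<alpha> * of_real q ^ n))
        ** (C - mat (\<alpha> * of_real q ^ n))) ** qbracket A B C \<alpha> q n"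

text \<open>Existence of all inverses occurring in \<open>qbracket A B C \<alpha> q n\<close>, for all \<open>n\<close>.
  (\<^const>\<open>matrix_inv\<close> is unspecified on singular matrices.)\<close>

definition qbracket_defined :: "complex^'n^'n \<Rightarrow> complex^'n^'n \<Rightarrow> complex \<Rightarrow> real \<Rightarrow> bool" where
  "qbracket_defined A B \<alpha> q \<longleftrightarrow>
     (\<forall>k. invertible (A - mat (\<alpha> * of_real q ^ k)) \<and> invertible (B - mat (\<alpha> * of_real q ^ k)))"

definition Theta_term :: "complex \<Rightarrow> complex^'n^'n \<Rightarrow> complex^'n^'n \<Rightarrow> complex^'n^'n \<Rightarrow> real \<Rightarrow> complex
    \<Rightarrow> nat \<Rightarrow> complex^'n^'n" where
  "Theta_term \<alpha> A B C q z n =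
     mat (qpochhammer (\<alpha> / of_real q) q n) ** qbracket A B C \<alpha> q n ** mat (z ^ n)"

definition Theta :: "complex \<Rightarrow> complex^'n^'n \<Rightarrow> complex^'n^'n \<Rightarrow> complex^'n^'n \<Rightarrow> real \<Rightarrow> complex
    \<Rightarrow> complex^'n^'n" where
  "Theta \<alpha> A B C q z = (\<Sum>n. Theta_term \<alpha> A B C q z n)"

text \<open>A choice of logarithm \<open>L\<close> on the non-zero complex numbers, not assumed continuous.\<close>

definition is_logarithm :: "(complex \<Rightarrow> complex) \<Rightarrow> bool" where
  "is_logarithm L \<longleftrightarrow> (\<forall>x. x \<noteq> 0 \<longrightarrow> exp (L x) = x)"

definition logq :: "(complex \<Rightarrow> complex) \<Rightarrow> real \<Rightarrow> complex \<Rightarrow> complex" where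
  "logq L q x = L x / of_real (ln q)"

text \<open>The function \<open>z \<mapsto> z^(- log_q x) \<Theta>^(qx)(B, A; C; q, q/z) v\<close> and the set of those
  \<open>z\<close> where its series converges; \<open>powr\<close> is the principal branch of the power.\<close>

definition series_sol :: "(complex \<Rightarrow> complex) \<Rightarrow> real \<Rightarrow> complex^'n^'n \<Rightarrow> complex^'n^'n \<Rightarrow> complex^'n^'n
    \<Rightarrow> complex \<Rightarrow> complex^'n \<Rightarrow> complex \<Rightarrow> complex^'n" where
  "series_sol L q A B C x v z =
     z powr (- logq L q x) *s (Theta (of_real q * x) B A C q (of_real q / z) *v v)"

definition series_dom :: "real \<Rightarrow> complex^'n^'n \<Rightarrow> complex^'n^'n \<Rightarrow> complex^'n^'n \<Rightarrow> complex
    \<Rightarrow> complex set" where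
  "series_dom q A B C x =
     {z. z \<noteq> 0 \<and> summable (Theta_term (of_real q * x) B A C q (of_real q / z))}"

text \<open>\<open>f\<close>, defined on \<open>D\<close>, satisfies the q-difference equation wherever all the terms of
  the equation are defined.\<close>

definition solves_qhyp_on :: "real \<Rightarrow> complex^'n^'n \<Rightarrow> complex^'n^'n \<Rightarrow> complex^'n^'n \<Rightarrow> complex set
    \<Rightarrow> (complex \<Rightarrow> complex^'n) \<Rightarrow> bool" where
  "solves_qhyp_on q A B C D f \<longleftrightarrow>
     (\<forall>z. z / of_real q \<in> D \<and> z \<in> D \<and> of_real q * z \<in> D \<longrightarrow>
        (of_real q - z) *s f (z / of_real q)
        + (mat z ** (A + B) - C - mat (of_real q)) *v f z
        + (C - mat z ** (A ** B)) *v f (of_real q * z) = 0)"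

text \<open>Linear independence over the complex numbers of a finite family of germs at infinity. This
  implies linear independence as functions on any set containing a neighbourhood of infinity.\<close>

definition lin_indep_at_infinity :: "('i::finite \<Rightarrow> complex \<Rightarrow> complex^'n) \<Rightarrow> bool" where
  "lin_indep_at_infinity F \<longleftrightarrow>
     (\<forall>c. (\<forall>\<^sub>F z in at_infinity. (\<Sum>i\<in>UNIV. c i *s F i z) = 0) \<longrightarrow> (\<forall>i. c i = 0))"

end

theory Submission
  imports Defs
begin

text \<open>
  Put \<open>f(z) = z^s \<Sum> u\<^sub>n z^(-n)\<close> with \<open>s = - log\<^sub>q x\<close>, so that replacing \<open>z\<close> by \<open>q z\<close>
  multiplies the \<open>n\<close>-th summand by \<open>1/t\<^sub>n\<close>, where \<open>t\<^sub>n = x q^n\<close>. Since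
  \<open>t\<^sup>2 - (A + B) t + A B = (A - t)(B - t)\<close>, comparing coefficients turns the equation into
  \<open>(A - t\<^sub>n)(B - t\<^sub>n) u\<^sub>n = q (1 - t\<^sub>n\<^sub>-\<^sub>1)(C - t\<^sub>n) u\<^sub>n\<^sub>-\<^sub>1\<close>
  for \<open>n > 0\<close>, together with the indicial equation \<open>(A - x)(B - x) u\<^sub>0 = 0\<close>. The recursion
  is the one that produces \<open>\<Theta>^(q x)(B, A; C; q, q/z) u\<^sub>0\<close>, and the indicial equation holds for
  an eigenvector of \<open>B\<close> if \<open>x = b\<^sub>i\<close> and for \<open>(a\<^sub>i - B)\<inverse> f\<^sub>i\<close> with an eigenvector \<open>f\<^sub>i\<close> of
  \<open>A\<close> if \<open>x = a\<^sub>i\<close>. So the equation holds wherever the series converge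
  (\<open>series_sol_solves\<close>). They converge near infinity by the ratio test, because \<open>A\<close> and \<open>B\<close> are
  invertible, and thus the inverses of \<open>A - t\<^sub>n\<close> and \<open>B - t\<^sub>n\<close> are bounded as \<open>t\<^sub>n \<rightarrow> 0\<close>.

  For linear independence, collect the solutions with the same \<open>x\<close> into one series with leading
  vector \<open>V\<^sub>x\<close>, and restrict a vanishing combination to the points \<open>z q^(-n)\<close>. There
  it reads \<open>\<Sum>\<^sub>x \<Sum>\<^sub>k (x q^k)^n w\<^sub>x\<^sub>,\<^sub>k = 0\<close>, an exponential sum in \<open>n\<close>. Its bases \<open>x q^k\<close> are
  pairwise different: an equality \<open>x = y q^(1+k)\<close> between eigenvalues would make one of the
  matrices \<open>A - y q^(1+k)\<close>, \<open>B - y q^(1+k)\<close> singular. Hence all \<open>w\<^sub>x\<^sub>,\<^sub>0\<close>, and with them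
  all \<open>V\<^sub>x\<close>, vanish (\<open>leading_coeffs_zero\<close>). As no eigenvalue is shared by \<open>A\<close> and \<open>B\<close>,
  each \<open>V\<^sub>x = 0\<close> is a linear relation within a single one of the two eigenbases.

  Passing to a sequence of points avoids analytic continuation across the branch cut of \<open>powr\<close>:
  on the ray through \<open>z\<close> the principal power satisfies \<open>(q z)^s = q^s z^s\<close> exactly.
\<close>

section \<open>Exponential sums\<close>

text \<open>The operator \<open>h(n) \<mapsto> h(n + 1) - \<mu> h(n)\<close> removes the base \<open>\<mu>\<close> from an exponential sum, multiplies
  the other coefficients by nonzero factors and preserves the bound \<open>O(r^n)\<close>; this gives an induction
  on the number of bases.\<close>

lemma exponential_sum_coeff_zero:
  fixes l w :: "'i \<Rightarrow> complex" and r M :: real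
  assumes "finite I" "inj_on l I" "0 < r"
    and "\<And>n. norm (\<Sum>i\<in>I. w i * l i ^ n) \<le> M * r ^ n"
    and "i \<in> I" "r < norm (l i)"
  shows "w i = 0"
  using assms
proof (induction I arbitrary: w M i rule: finite_induct)
  case empty
  then show ?case by simp
next
  case (insert j I)
  have others: "w i = 0" if i: "i \<in> I" "r < norm (l i)" for i
  proof -
    have shift: "(\<Sum>i\<in>I. w i * (l i - l j) * l i ^ n)
        = (\<Sum>i\<in>insert j I. w i * l i ^ Suc n) - l j * (\<Sum>i\<in>insert j I. w i * l i ^ n)" for n
    proof -
      have "(\<Sum>i\<in>insert j I. w i * l i ^ Suc n) - l j * (\<Sum>i\<in>insert j I. w i * l i ^ n)
          = (\<Sum>i\<in>insert j I. w i * (l i - l j) * l i ^ n)"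
        by (simp only: sum_distrib_left flip: sum_subtractf) (simp add: algebra_simps)
      then show ?thesis using insert.hyps by simp
    qed
    have "norm (\<Sum>i\<in>I. w i * (l i - l j) * l i ^ n) \<le> (M * r + norm (l j) * M) * r ^ n" for n
    proof -
      have "norm (\<Sum>i\<in>I. w i * (l i - l j) * l i ^ n)
          \<le> norm (\<Sum>i\<in>insert j I. w i * l i ^ Suc n)
            + norm (l j) * norm (\<Sum>i\<in>insert j I. w i * l i ^ n)"
        unfolding shift norm_mult[symmetric] by (rule norm_triangle_ineq4)
      also have "\<dots> \<le> M * r ^ Suc n + norm (l j) * (M * r ^ n)"
        by (intro add_mono mult_left_mono insert.prems) auto
      finally show ?thesis by (simp add: algebra_simps)
    qed
    then have "w i * (l i - l j) = 0"
      using insert.IH[of "\<lambda>i. w i * (l i - l j)"] insert.prems i by auto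
    moreover have "l i \<noteq> l j"
      using insert.prems(1) insert.hyps i by (auto simp: inj_on_def)
    ultimately show "w i = 0" by simp
  qed
  show ?case
  proof (cases "i = j")
    case False
    then show ?thesis using others insert.prems by simp
  next
    case True
    then have j: "r < norm (l j)" using insert.prems by simp
    then have jpos: "0 < norm (l j)" using \<open>0 < r\<close> by linarith
    define S where "S = (\<Sum>i\<in>I. norm (w i))"
    \<comment> \<open>All other terms of modulus above \<open>r\<close> are gone, so the one with base \<open>l j\<close> is itself \<open>O(r^n)\<close>.\<close>
    have bound: "norm (w j) \<le> (M + S) * (r / norm (l j)) ^ n" for n
    proof -
      have "norm (\<Sum>i\<in>I. w i * l i ^ n) \<le> (\<Sum>i\<in>I. norm (w i) * r ^ n)"
      proof (rule sum_norm_le)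
        fix i assume i: "i \<in> I"
        show "norm (w i * l i ^ n) \<le> norm (w i) * r ^ n"
        proof (cases "r < norm (l i)")
          case True
          then show ?thesis using others[OF i] by simp
        next
          case False
          then show ?thesis
            by (auto simp: norm_mult norm_power intro!: mult_left_mono power_mono)
        qed
      qed
      then have "norm (\<Sum>i\<in>I. w i * l i ^ n) \<le> S * r ^ n"
        by (simp add: S_def sum_distrib_right)
      moreover have "norm (w j * l j ^ n) \<le> norm (\<Sum>i\<in>insert j I. w i * l i ^ n)
          + norm (\<Sum>i\<in>I. w i * l i ^ n)"
        using insert.hyps norm_triangle_ineq4[of "\<Sum>i\<in>insert j I. w i * l i ^ n" "\<Sum>i\<in>I. w i * l i ^ n"]
        by simp
      ultimately have "norm (w j) * norm (l j) ^ n \<le> (M + S) * r ^ n"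
        using insert.prems(3)[of n] by (simp add: norm_mult norm_power algebra_simps)
      moreover have "0 < norm (l j) ^ n"
        using jpos by (intro zero_less_power)
      ultimately show ?thesis
        by (simp add: power_divide pos_le_divide_eq)
    qed
    have "norm (r / norm (l j)) < 1"
      using j jpos \<open>0 < r\<close> by (simp add: pos_divide_less_eq del: zero_less_norm_iff)
    then have "(\<lambda>n. (M + S) * (r / norm (l j)) ^ n) \<longlonglongrightarrow> (M + S) * 0"
      by (intro tendsto_mult tendsto_const LIMSEQ_power_zero)
    then have "norm (w j) \<le> (M + S) * 0"
      using bound by (intro LIMSEQ_le_const) auto
    then show ?thesis using True by simp
  qed
qed

lemma power_series_truncation_bound:
  fixes d :: "nat \<Rightarrow> complex" and t :: real
  assumes d: "summable (\<lambda>k. norm (d k))" and t: "0 \<le> t" "t \<le> 1"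
  shows "norm ((\<Sum>k. d k * of_real t ^ k) - (\<Sum>k<K. d k * of_real t ^ k)) \<le> (\<Sum>k. norm (d k)) * t ^ K"
proof -
  have le: "norm (d k * of_real t ^ k) \<le> norm (d k)" for k
    using t by (simp add: norm_mult norm_power mult_left_le power_le_one)
  have sm: "summable (\<lambda>k. norm (d k * of_real t ^ k))"
    by (rule summable_comparison_test'[OF d, of 0]) (use le in auto)
  have "(\<Sum>k. d k * of_real t ^ k) - (\<Sum>k<K. d k * of_real t ^ k)
      = (\<Sum>k. d (k + K) * of_real t ^ (k + K))"
    using suminf_split_initial_segment[OF summable_norm_cancel[OF sm], of K] by simp
  also have "norm \<dots> \<le> (\<Sum>k. norm (d (k + K) * of_real t ^ (k + K)))"
    by (rule summable_norm) (simp only: summable_iff_shift[of "\<lambda>k. norm (d k * of_real t ^ k)"] sm)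
  also have "\<dots> \<le> (\<Sum>k. norm (d (k + K)) * t ^ K)"
  proof (rule suminf_le)
    show "norm (d (k + K) * of_real t ^ (k + K)) \<le> norm (d (k + K)) * t ^ K" for k
    proof -
      have "t ^ (k + K) \<le> t ^ K"
        using t by (intro power_decreasing) auto
      then show ?thesis
        using t by (simp add: norm_mult norm_power mult_left_mono)
    qed
    show "summable (\<lambda>k. norm (d (k + K) * of_real t ^ (k + K)))"
      by (simp only: summable_iff_shift[of "\<lambda>k. norm (d k * of_real t ^ k)"] sm)
    show "summable (\<lambda>k. norm (d (k + K)) * t ^ K)"
      by (intro summable_mult2) (simp only: summable_iff_shift[of "\<lambda>k. norm (d k)"] d)
  qed
  also have "\<dots> = (\<Sum>k. norm (d (k + K))) * t ^ K"
    by (rule suminf_mult2[symmetric]) (simp only: summable_iff_shift[of "\<lambda>k. norm (d k)"] d)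
  also have "\<dots> \<le> (\<Sum>k. norm (d k)) * t ^ K"
  proof (intro mult_right_mono)
    show "(\<Sum>k. norm (d (k + K))) \<le> (\<Sum>k. norm (d k))"
      using suminf_split_initial_segment[OF d, of K] by (simp add: sum_nonneg)
  qed (use t in simp)
  finally show ?thesis .
qed

text \<open>Cutting each power series at an order \<open>K\<close> with \<open>m q^K < \<bar>x\<bar>\<close> leaves a finite exponential
  sum with bases \<open>x q^k\<close> that is \<open>O((m q^K)^n)\<close>, where \<open>m\<close> bounds the moduli of the
  elements of \<open>X\<close>; the base \<open>x q^0\<close> exceeds that rate. Higher
  coefficients cannot be ignored from the start, since a term \<open>x q^k\<close> with \<open>k > 0\<close> may dominate \<open>y q^0\<close>
  for another base \<open>y\<close>.\<close>

lemma leading_coeffs_zero: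
  fixes X :: "complex set" and d :: "complex \<Rightarrow> nat \<Rightarrow> complex" and q :: real
  assumes q: "0 < q" "q < 1" and X: "finite X" "0 \<notin> X"
    and sep: "\<And>x y k. x \<in> X \<Longrightarrow> y \<in> X \<Longrightarrow> x \<noteq> y * of_real q ^ Suc k"
    and sm: "\<And>x. x \<in> X \<Longrightarrow> summable (\<lambda>k. norm (d x k))"
    and zero: "\<And>n. (\<Sum>x\<in>X. x ^ n * (\<Sum>k. d x k * of_real (q ^ n) ^ k)) = 0"
    and x: "x \<in> X"
  shows "d x 0 = 0"
proof -
  define m where "m = (\<Sum>y\<in>X. norm y)"
  have le_m: "norm y \<le> m" if "y \<in> X" for y
    unfolding m_def using X that by (intro member_le_sum) auto
  have xpos: "0 < norm x" using x X by auto
  then have mpos: "0 < m" using le_m[OF x] by linarith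
  obtain K where K: "q ^ K < norm x / m"
    using real_arch_pow_inv[of "norm x / m" q] q xpos mpos by auto
  define r where "r = m * q ^ K"
  have r: "0 < r" "r < norm x"
    using K q mpos by (auto simp: r_def field_simps)
  define I where "I = X \<times> {..<K}"
  define l where "l = (\<lambda>(y, k). y * of_real q ^ k :: complex)"
  have distinct: "inj_on l I"
  proof -
    have less: False if "y \<in> X" "y' \<in> X" "y * of_real q ^ k = y' * of_real q ^ k'" "k < k'"
      for y y' and k k' :: nat
    proof -
      obtain j where "k' = k + Suc j" using \<open>k < k'\<close> less_iff_Suc_add by auto
      then have "y = y' * of_real q ^ Suc j" using that q by (simp add: power_add)
      then show False using sep that by blast
    qed
    show ?thesis
    proof (rule inj_onI)
      fix p p' assume p: "p \<in> I" "p' \<in> I" "l p = l p'"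
      obtain y k y' k' where pp: "p = (y, k)" "p' = (y', k')" by (cases p, cases p')
      have *: "y \<in> X" "y' \<in> X" "y * of_real q ^ k = y' * of_real q ^ k'"
        using p by (auto simp: pp I_def l_def)
      have "k = k'"
        using less[OF *] less[OF *(2,1) *(3)[symmetric]] by (metis linorder_neqE_nat)
      then show "p = p'" using * q by (simp add: pp)
    qed
  qed
  have Kpos: "0 < K"
  proof (rule ccontr)
    assume "\<not> 0 < K"
    then have "m < norm x" using r by (simp add: r_def)
    then show False using le_m[OF x] by simp
  qed
  define M where "M = (\<Sum>y\<in>X. \<Sum>k. norm (d y k))"
  have bound: "norm (\<Sum>i\<in>I. (case i of (y, k) \<Rightarrow> d y k) * l i ^ n) \<le> M * r ^ n" for n
  proof -
    define t where "t = q ^ n"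
    have t: "0 \<le> t" "t \<le> 1" using q by (auto simp: t_def power_le_one)
    have "(\<Sum>i\<in>I. (case i of (y, k) \<Rightarrow> d y k) * l i ^ n)
        = (\<Sum>y\<in>X. \<Sum>k<K. d y k * (y * of_real q ^ k) ^ n)"
      by (simp add: I_def l_def sum.cartesian_product case_prod_unfold)
    also have "\<dots> = (\<Sum>y\<in>X. y ^ n * (\<Sum>k<K. d y k * of_real t ^ k))"
      by (simp add: sum_distrib_left t_def power_mult_distrib mult_ac flip: power_mult)
    also have "\<dots> = - (\<Sum>y\<in>X. y ^ n * ((\<Sum>k. d y k * of_real t ^ k) - (\<Sum>k<K. d y k * of_real t ^ k)))"
      using zero[of n] by (simp add: t_def right_diff_distrib sum_subtractf)
    also have "norm \<dots> \<le> (\<Sum>y\<in>X. m ^ n * ((\<Sum>k. norm (d y k)) * t ^ K))"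
      unfolding norm_minus_cancel
    proof (rule sum_norm_le)
      fix y assume y: "y \<in> X"
      show "norm (y ^ n * ((\<Sum>k. d y k * of_real t ^ k) - (\<Sum>k<K. d y k * of_real t ^ k)))
          \<le> m ^ n * ((\<Sum>k. norm (d y k)) * t ^ K)"
        unfolding norm_mult norm_power
        using le_m[OF y] mpos
        by (intro mult_mono power_mono power_series_truncation_bound sm y t) auto
    qed
    also have "\<dots> = M * r ^ n"
      by (simp add: M_def r_def t_def sum_distrib_left sum_distrib_right power_mult_distrib mult_ac
          flip: power_mult)
    finally show ?thesis .
  qed
  have fin: "finite I" using X by (simp add: I_def)
  have mem: "(x, 0) \<in> I" using x Kpos by (simp add: I_def)
  show ?thesis
    using exponential_sum_coeff_zero[OF fin distinct r(1) bound mem] r(2) by (simp add: l_def)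
qed

section \<open>Matrices, resolvents and spectra\<close>

lemma mat_vector_mult: "mat c *v v = c *s (v :: 'a::comm_semiring_1 ^ 'n)"
  by (simp add: vec_eq_iff mat_def matrix_vector_mult_def if_distrib[where f = "\<lambda>x. x * _"]
      cong: if_cong)

lemma matrix_inv_cancel:
  fixes M :: "'a::semiring_1^'n^'n"
  assumes "invertible M"
  shows "M *v (matrix_inv M *v v) = v" and "matrix_inv M *v (M *v v) = v"
proof -
  have "M ** matrix_inv M = mat 1 \<and> matrix_inv M ** M = mat 1"
    unfolding matrix_inv_def by (rule someI_ex) (use assms in \<open>auto simp: invertible_def\<close>)
  then show "M *v (matrix_inv M *v v) = v" "matrix_inv M *v (M *v v) = v"
    by (simp_all add: matrix_vector_mul_assoc)
qed

lemma norm_vector_scalar_mult: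
  fixes v :: "'a::real_normed_div_algebra ^ 'n"
  shows "norm (c *s v) = norm c * norm v"
  by (simp add: norm_vec_def norm_mult L2_set_right_distrib)

lemma bounded_linear_vector_scalar_mult: "bounded_linear (\<lambda>v :: complex^'n. c *s v)"
proof -
  have "(\<lambda>v :: complex^'n. c *s v) = (*v) (mat c)" by (simp add: mat_vector_mult fun_eq_iff)
  then show ?thesis by (simp only: matrix_vector_mul_bounded_linear)
qed

lemma bounded_linear_apply_matrix: "bounded_linear (\<lambda>M :: complex^'n^'n. M *v v)"
proof -
  have "linear (\<lambda>M :: complex^'n^'n. M *v v)"
    by (rule linearI)
      (simp_all add: vec_eq_iff matrix_vector_mult_def scaleR_sum_right distrib_right sum.distrib)
  then show ?thesis by (simp add: linear_conv_bounded_linear)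
qed

lemma invertible_iff_0_notin_spectrum: "invertible M \<longleftrightarrow> 0 \<notin> spectrum M"
  by (auto simp: invertible_left_inverse matrix_left_invertible_ker spectrum_def)

lemma invertible_diff_mat_iff: "invertible (M - mat c) \<longleftrightarrow> c \<notin> spectrum M"
  by (auto simp: invertible_iff_0_notin_spectrum spectrum_def matrix_vector_mult_diff_rdistrib
      mat_vector_mult)

lemma invertible_mat_diff_iff: "invertible (mat c - M) \<longleftrightarrow> c \<notin> spectrum M"
  by (auto simp: invertible_left_inverse matrix_left_invertible_ker spectrum_def
      matrix_vector_mult_diff_rdistrib mat_vector_mult)

text \<open>An invertible \<open>M\<close> satisfies \<open>norm u \<le> c * norm (M u)\<close>; a perturbation of norm at most \<open>1 / (2 c)\<close>
  costs at most half of the left-hand side.\<close>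

lemma inverse_bounded_near_invertible:
  fixes M :: "complex^'n^'n"
  assumes M: "invertible M"
  obtains K \<delta> where "0 < K" "0 < \<delta>"
    "\<And>t v. norm t < \<delta> \<Longrightarrow> invertible (M - mat t) \<Longrightarrow> norm (matrix_inv (M - mat t) *v v) \<le> K * norm v"
proof -
  obtain c where c: "0 < c" "\<And>v. norm (matrix_inv M *v v) \<le> norm v * c"
    using bounded_linear.pos_bounded[OF matrix_vector_mul_bounded_linear[of "matrix_inv M"]] by auto
  have "norm (matrix_inv (M - mat t) *v v) \<le> 2 * c * norm v"
    if t: "norm t < 1 / (2 * c)" and inv: "invertible (M - mat t)" for t v
  proof -
    define u where "u = matrix_inv (M - mat t) *v v"
    have Mu: "M *v u = v + t *s u"
      using matrix_inv_cancel(1)[OF inv, of v]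
      by (simp add: u_def matrix_vector_mult_diff_rdistrib mat_vector_mult algebra_simps)
    have "norm u \<le> norm (M *v u) * c"
      using c(2)[of "M *v u"] by (simp add: matrix_inv_cancel(2)[OF M])
    also have "\<dots> \<le> (norm v + norm t * norm u) * c"
      unfolding Mu using c(1) norm_triangle_ineq[of v "t *s u"]
      by (intro mult_right_mono) (simp_all add: norm_vector_scalar_mult)
    finally have "norm u \<le> c * norm v + (norm t * c) * norm u"
      by (simp add: algebra_simps)
    moreover have "(norm t * c) * norm u \<le> 1 / 2 * norm u"
      using t c(1) by (intro mult_right_mono) (simp_all add: field_simps)
    ultimately have "norm u \<le> 2 * c * norm v" by linarith
    then show ?thesis by (simp add: u_def)
  qed
  then show thesis using that[of "2 * c" "1 / (2 * c)"] c(1) by simp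
qed

section \<open>Convergence of the series near infinity\<close>

lemma Theta_term_mult_vector:
  "Theta_term \<alpha> A B C q z n *v v = (qpochhammer (\<alpha> / of_real q) q n * z ^ n) *s (qbracket A B C \<alpha> q n *v v)"
  by (simp add: Theta_term_def mat_vector_mult vector_scalar_commute vector_smult_assoc
      flip: matrix_vector_mul_assoc)

lemma Theta_term_shift:
  "Theta_term \<alpha> A B C q (t * z) n *v v = t ^ n *s (Theta_term \<alpha> A B C q z n *v v)"
  by (simp add: Theta_term_mult_vector power_mult_distrib vector_smult_assoc mult_ac)

lemma Theta_term_0: "Theta_term \<alpha> A B C q z 0 *v v = v"
  by (simp add: Theta_term_mult_vector qpochhammer_def)

lemma Theta_term_Suc:
  assumes "0 < q"
  shows "Theta_term (of_real q * x) A B C q z (Suc n) *v v =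
    (z * (1 - x * of_real q ^ n)) *s
      (matrix_inv (A - mat (x * of_real q ^ Suc n)) *v (matrix_inv (B - mat (x * of_real q ^ Suc n)) *v
        ((C - mat (x * of_real q ^ Suc n)) *v (Theta_term (of_real q * x) A B C q z n *v v))))"
proof -
  have "of_real q * x * of_real q ^ n = x * of_real q ^ Suc n" by simp
  moreover have "of_real q * x / of_real q = x" using assms by simp
  ultimately show ?thesis
    by (simp add: Theta_term_mult_vector qpochhammer_def vector_smult_assoc vector_scalar_commute mult_ac
      flip: matrix_vector_mul_assoc)
qed

text \<open>The quotient of consecutive terms is \<open>z\<close> times a matrix that stays bounded, because its two inverses
  are taken near the invertible matrices \<open>A\<close> and \<open>B\<close>. The radius is uniform in the vector \<open>v\<close>, so
  the matrix series itself converges.\<close>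

lemma Theta_terms_abs_summable:
  fixes A B C :: "complex^'n^'n"
  assumes q: "0 < q" "q < 1" and inv: "invertible A" "invertible B"
    and def: "qbracket_defined A B (of_real q * x) q"
  obtains R where "0 < R"
    "\<And>z v. norm z < R \<Longrightarrow> summable (\<lambda>n. norm (Theta_term (of_real q * x) A B C q z n *v v))"
proof -
  obtain KA \<delta>A where A: "0 < KA" "0 < \<delta>A" "\<And>t v. norm t < \<delta>A \<Longrightarrow> invertible (A - mat t) \<Longrightarrow>
      norm (matrix_inv (A - mat t) *v v) \<le> KA * norm v"
    using inverse_bounded_near_invertible[OF inv(1)] by blast
  obtain KB \<delta>B where B: "0 < KB" "0 < \<delta>B" "\<And>t v. norm t < \<delta>B \<Longrightarrow> invertible (B - mat t) \<Longrightarrow>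
      norm (matrix_inv (B - mat t) *v v) \<le> KB * norm v"
    using inverse_bounded_near_invertible[OF inv(2)] by blast
  obtain KC where C: "0 < KC" "\<And>v. norm (C *v v) \<le> norm v * KC"
    using bounded_linear.pos_bounded[OF matrix_vector_mul_bounded_linear[of C]] by auto
  define t where "t n = x * of_real q ^ n" for n
  have defined: "invertible (A - mat (t (Suc n)))" "invertible (B - mat (t (Suc n)))" for n
    using def by (auto simp: qbracket_defined_def t_def mult_ac)
  have "(\<lambda>n. of_real q ^ n :: complex) \<longlonglongrightarrow> 0"
    using q by (intro LIMSEQ_power_zero) simp
  then have "t \<longlonglongrightarrow> x * 0" unfolding t_def by (intro tendsto_mult tendsto_const)
  then have "(\<lambda>n. norm (t n)) \<longlonglongrightarrow> 0" using tendsto_norm_zero by simp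
  then have "\<forall>\<^sub>F n in sequentially. norm (t n) < min 1 (min \<delta>A \<delta>B)"
    using A(2) B(2) by (intro order_tendstoD) auto
  then obtain n0 where "\<And>n. n \<ge> n0 \<Longrightarrow> norm (t n) < min 1 (min \<delta>A \<delta>B)"
    by (auto simp: eventually_sequentially)
  then have n0: "norm (t n) < 1" "norm (t n) < \<delta>A" "norm (t n) < \<delta>B" if "n \<ge> n0" for n
    using that by force+
  define K where "K = 2 * (KA * (KB * (KC + 1)))"
  have K: "0 < K" using A B C by (simp add: K_def)
  have ratio: "norm (Theta_term (of_real q * x) A B C q z (Suc n) *v v)
      \<le> norm z * K * norm (Theta_term (of_real q * x) A B C q z n *v v)" if n: "n \<ge> n0" for n z v
  proof -
    define y where "y = Theta_term (of_real q * x) A B C q z n *v v"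
    let ?s = "t (Suc n)"
    let ?Cy = "(C - mat ?s) *v y"
    have s: "norm ?s < 1" "norm ?s < \<delta>A" "norm ?s < \<delta>B" using n0[of "Suc n"] n by auto
    have Cy: "norm ?Cy \<le> (KC + 1) * norm y"
    proof -
      have "norm ?Cy \<le> norm (C *v y) + norm ?s * norm y"
        using norm_triangle_ineq4[of "C *v y" "?s *s y"]
        by (simp add: matrix_vector_mult_diff_rdistrib mat_vector_mult norm_vector_scalar_mult)
      also have "norm ?s * norm y \<le> 1 * norm y"
        using s(1) by (intro mult_right_mono) auto
      finally show ?thesis using C(2)[of y] by (simp add: algebra_simps)
    qed
    have "norm (matrix_inv (A - mat ?s) *v (matrix_inv (B - mat ?s) *v ?Cy))
        \<le> KA * norm (matrix_inv (B - mat ?s) *v ?Cy)"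
      by (intro A(3) s defined)
    also have "\<dots> \<le> KA * (KB * norm ?Cy)"
      using A(1) by (intro mult_left_mono B(3) s defined) simp
    also have "\<dots> \<le> KA * (KB * ((KC + 1) * norm y))"
      using A(1) B(1) by (intro mult_left_mono Cy) simp_all
    finally have inner: "norm (matrix_inv (A - mat ?s) *v (matrix_inv (B - mat ?s) *v ?Cy))
        \<le> KA * (KB * ((KC + 1) * norm y))" .
    have scalar: "norm (z * (1 - t n)) \<le> norm z * 2"
      using norm_triangle_ineq4[of 1 "t n"] n0(1)[OF n]
      by (auto simp: norm_mult intro!: mult_left_mono)
    have "norm (Theta_term (of_real q * x) A B C q z (Suc n) *v v)
        = norm (z * (1 - t n)) * norm (matrix_inv (A - mat ?s) *v (matrix_inv (B - mat ?s) *v ?Cy))"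
      unfolding Theta_term_Suc[OF q(1)] norm_vector_scalar_mult by (simp add: y_def t_def)
    also have "\<dots> \<le> (norm z * 2) * (KA * (KB * ((KC + 1) * norm y)))"
      by (intro mult_mono scalar inner) auto
    also have "\<dots> = norm z * K * norm y" by (simp add: K_def)
    finally show ?thesis by (simp add: y_def)
  qed
  show thesis
  proof (rule that[of "1 / K"])
    show "0 < 1 / K" using K by simp
    show "summable (\<lambda>n. norm (Theta_term (of_real q * x) A B C q z n *v v))"
      if "norm z < 1 / K" for z v
    proof (rule summable_ratio_test[of "norm z * K" n0])
      show "norm z * K < 1" using that K by (simp add: field_simps)
    qed (use ratio in auto)
  qed
qed

lemma summable_matrixI:
  fixes f :: "nat \<Rightarrow> complex^'n^'m"
  assumes "\<And>v. summable (\<lambda>n. f n *v v)"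
  shows "summable f"
proof -
  have "(\<lambda>n. f n $ i $ j) sums (\<Sum>n. f n $ i $ j)" for i j
  proof -
    have "summable (\<lambda>n. (f n *v axis j 1) $ i)"
      by (rule bounded_linear.summable[OF bounded_linear_vec_nth assms])
    moreover have "(f n *v axis j 1) $ i = f n $ i $ j" for n
      by (simp add: matrix_vector_mult_def axis_def if_distrib cong: if_cong)
    ultimately show ?thesis by (simp add: summable_sums)
  qed
  then have "f sums (\<chi> i j. \<Sum>n. f n $ i $ j)"
    unfolding sums_def by (intro vec_tendstoI) (simp add: sum_component)
  then show ?thesis by (rule sums_summable)
qed

lemma eventually_Theta_terms_abs_summable:
  fixes A B C :: "complex^'n^'n"
  assumes q: "0 < q" "q < 1" and inv: "invertible A" "invertible B"
    and def: "qbracket_defined B A (of_real q * x) q"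
  shows "\<forall>\<^sub>F z in at_infinity.
    \<forall>v. summable (\<lambda>n. norm (Theta_term (of_real q * x) B A C q (of_real q / z) n *v v))"
proof -
  obtain R where R: "0 < R"
    "\<And>z v. norm z < R \<Longrightarrow> summable (\<lambda>n. norm (Theta_term (of_real q * x) B A C q z n *v v))"
    using Theta_terms_abs_summable[OF q inv(2,1) def] by blast
  have "norm (of_real q / z) < R" if z: "q / R + 1 \<le> norm z" for z :: complex
  proof -
    have "0 < q / R" using R q by simp
    then have "0 < norm z" "q / R < norm z" using z by linarith+
    then show ?thesis
      using R(1) q by (simp add: norm_divide field_simps)
  qed
  then show ?thesis
    unfolding eventually_at_infinity by (intro exI[of _ "q / R + 1"] allI impI R(2))
qed

lemma eventually_in_series_dom:
  fixes A B C :: "complex^'n^'n"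
  assumes q: "0 < q" "q < 1" and inv: "invertible A" "invertible B"
    and def: "qbracket_defined B A (of_real q * x) q"
  shows "\<forall>\<^sub>F z in at_infinity. z \<in> series_dom q A B C x"
proof -
  have nz: "\<forall>\<^sub>F z :: complex in at_infinity. z \<noteq> 0"
    unfolding eventually_at_infinity by (intro exI[of _ 1]) auto
  show ?thesis
    using eventually_Theta_terms_abs_summable[OF assms, of C] nz
  proof eventually_elim
    case (elim z)
    then have "summable (Theta_term (of_real q * x) B A C q (of_real q / z))"
      by (intro summable_matrixI summable_norm_cancel[where 'a = "complex^'n"]) simp
    then show ?case using elim by (simp add: series_dom_def)
  qed
qed

section \<open>The q-difference equation\<close>

lemma shift_powr_logq:
  assumes q: "0 < q" "q < 1" and L: "is_logarithm L" and x: "x \<noteq> 0"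
  shows "(of_real q * z) powr (- logq L q x) = z powr (- logq L q x) / x"
proof (cases "z = 0")
  case False
  have lnq: "ln q \<noteq> 0" using q by simp
  have "(of_real q * z) powr (- logq L q x) = exp (- logq L q x * (of_real (ln q) + Ln z))"
    using False q by (simp add: powr_def Ln_times_of_real Ln_of_real)
  also have "\<dots> = exp (- logq L q x * of_real (ln q)) * exp (- logq L q x * Ln z)"
    by (simp add: ring_distribs flip: exp_add)
  also have "- logq L q x * of_real (ln q) = - L x" using lnq by (simp add: logq_def)
  also have "exp (- L x) = 1 / x" using L x by (simp add: is_logarithm_def exp_minus inverse_eq_divide)
  finally show ?thesis using False by (simp add: powr_def)
qed simp

lemma Theta_mult_vector_sums:
  assumes "z \<in> series_dom q A B C x"
  shows "(\<lambda>n. Theta_term (of_real q * x) B A C q (of_real q / z) n *v v) sums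
    (Theta (of_real q * x) B A C q (of_real q / z) *v v)"
  using assms unfolding series_dom_def Theta_def
  by (intro bounded_linear.sums[OF bounded_linear_apply_matrix] summable_sums) simp

text \<open>With \<open>t\<^sub>n = x q^n\<close> and \<open>y\<^sub>n\<close> the \<open>n\<close>-th term of the series at \<open>z\<close>, the terms with a factor \<open>z\<close>
  in the equation combine to \<open>g\<^sub>n = - (z / t\<^sub>n) (A - t\<^sub>n) (B - t\<^sub>n) y\<^sub>n\<close>. By the recursion the other
  terms are \<open>- g\<^sub>n\<^sub>+\<^sub>1\<close>. So the left-hand side telescopes to \<open>g\<^sub>0\<close>, which the indicial equation
  \<open>indicial\<close> makes zero.\<close>

lemma series_sol_solves:
  fixes A B C :: "complex^'n^'n"
  assumes q: "0 < q" "q < 1" and L: "is_logarithm L" and x: "x \<noteq> 0"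
    and def: "qbracket_defined B A (of_real q * x) q"
    and indicial: "(A - mat x) *v ((B - mat x) *v v) = 0"
  shows "solves_qhyp_on q A B C (series_dom q A B C x) (series_sol L q A B C x v)"
  unfolding solves_qhyp_on_def
proof (intro allI impI, elim conjE)
  fix z :: complex
  let ?D = "series_dom q A B C x"
  assume dom: "z / of_real q \<in> ?D" "z \<in> ?D" "of_real q * z \<in> ?D"
  have z: "z \<noteq> 0" using dom(2) by (simp add: series_dom_def)
  have q0: "(of_real q :: complex) \<noteq> 0" using q by simp
  define s where "s n = (of_real q :: complex) ^ n" for n
  have s0: "s n \<noteq> 0" for n using q0 by (simp add: s_def)
  define y where "y n = Theta_term (of_real q * x) B A C q (of_real q / z) n *v v" for n
  define Y Y1 Y2 where "Y = Theta (of_real q * x) B A C q (of_real q / z) *v v"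
    and "Y1 = Theta (of_real q * x) B A C q (of_real q / (z / of_real q)) *v v"
    and "Y2 = Theta (of_real q * x) B A C q (of_real q / (of_real q * z)) *v v"
  have Y: "y sums Y"
    unfolding y_def Y_def by (rule Theta_mult_vector_sums[OF dom(2)])
  have Y1: "(\<lambda>n. s n *s y n) sums Y1"
  proof -
    have "of_real q / (z / of_real q) = of_real q * (of_real q / z)" by simp
    then show ?thesis
      using Theta_mult_vector_sums[OF dom(1), of v] unfolding Y1_def s_def y_def
      by (simp only: Theta_term_shift)
  qed
  have Y2: "(\<lambda>n. inverse (s n) *s y n) sums Y2"
  proof -
    have "of_real q / (of_real q * z) = inverse (of_real q) * (of_real q / z)" using q0 by simp
    then show ?thesis
      using Theta_mult_vector_sums[OF dom(3), of v] unfolding Y2_def s_def y_def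
      by (simp only: Theta_term_shift power_inverse)
  qed
  have step: "(A - mat (x * s (Suc n))) *v ((B - mat (x * s (Suc n))) *v y (Suc n))
      = (of_real q / z * (1 - x * s n)) *s ((C - mat (x * s (Suc n))) *v y n)" for n
  proof -
    have "invertible (A - mat (x * s (Suc n)))" "invertible (B - mat (x * s (Suc n)))"
      using def by (auto simp: qbracket_defined_def s_def mult_ac)
    then show ?thesis
      unfolding y_def Theta_term_Suc[OF q(1)] s_def by (simp add: vector_scalar_commute matrix_inv_cancel)
  qed
  \<comment> \<open>In this form \<open>g\<close> tends to zero, since it is a combination of terms of the three convergent series.\<close>
  define g where "g n = z *s ((A + B) *v y n - (x * s n) *s y n
      - (A ** B) *v (inverse x *s (inverse (s n) *s y n)))" for n
  \<comment> \<open>In this form \<open>g 0\<close> vanishes, and the recursion applies to \<open>g (Suc n)\<close>.\<close>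
  have g_eq: "g n = (- z / (x * s n)) *s ((A - mat (x * s n)) *v ((B - mat (x * s n)) *v y n))" for n
    using x s0[of n]
    by (simp add: g_def vec_eq_iff matrix_vector_mult_diff_rdistrib matrix_vector_mult_add_rdistrib
        mat_vector_mult matrix_vector_mult_diff_distrib vector_scalar_commute
        flip: matrix_vector_mul_assoc) (simp add: field_simps)
  have g0: "g 0 = 0"
    unfolding g_eq by (simp add: s_def y_def Theta_term_0 indicial)
  have g_lim: "g \<longlonglongrightarrow> 0"
  proof -
    have "(\<lambda>n. z *s ((A + B) *v y n - x *s (s n *s y n) - (A ** B) *v (inverse x *s (inverse (s n) *s y n))))
        \<longlonglongrightarrow> z *s ((A + B) *v 0 - x *s 0 - (A ** B) *v (inverse x *s 0))"
      by (intro bounded_linear.tendsto[OF bounded_linear_vector_scalar_mult] tendsto_diff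
          bounded_linear.tendsto[OF matrix_vector_mul_bounded_linear] summable_LIMSEQ_zero
          sums_summable[OF Y] sums_summable[OF Y1] sums_summable[OF Y2])
    moreover have "z *s ((A + B) *v y n - x *s (s n *s y n)
        - (A ** B) *v (inverse x *s (inverse (s n) *s y n))) = g n" for n
      by (simp only: g_def vector_smult_assoc)
    ultimately show ?thesis by (simp only: vec.scale_zero_right matrix_vector_mult_0_right diff_self)
  qed
  \<comment> \<open>The \<open>n\<close>-th term of the left-hand side of the equation, without the common power of \<open>z\<close>.\<close>
  define h where "h n = (of_real q - z) *s (x *s (s n *s y n))
      + ((mat z ** (A + B) - C - mat (of_real q)) *v y n
      + (C - mat z ** (A ** B)) *v (inverse x *s (inverse (s n) *s y n)))" for n
  have h_eq: "h n = g n - g (Suc n)" for n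
  proof -
    have "g (Suc n) = (- z / (x * s (Suc n)) * (of_real q / z * (1 - x * s n)))
        *s ((C - mat (x * s (Suc n))) *v y n)"
      unfolding g_eq step by (simp add: vector_smult_assoc)
    also have "- z / (x * s (Suc n)) * (of_real q / z * (1 - x * s n)) = - (1 - x * s n) / (x * s n)"
      using z x s0[of n] q0 by (simp add: s_def field_simps)
    finally have *: "g (Suc n) = (- (1 - x * s n) / (x * s n)) *s ((C - mat (x * (of_real q * s n))) *v y n)"
      by (simp add: s_def)
    show ?thesis
      unfolding * using x s0[of n]
      by (simp add: h_def g_def vec_eq_iff matrix_vector_mult_diff_rdistrib matrix_vector_mult_add_rdistrib
        mat_vector_mult matrix_vector_mult_diff_distrib vector_scalar_commute
        flip: matrix_vector_mul_assoc) (simp add: field_simps)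
  qed
  have "h sums ((of_real q - z) *s (x *s Y1)
      + ((mat z ** (A + B) - C - mat (of_real q)) *v Y
      + (C - mat z ** (A ** B)) *v (inverse x *s Y2)))"
    unfolding h_def
    by (intro sums_add bounded_linear.sums[OF bounded_linear_vector_scalar_mult]
        bounded_linear.sums[OF matrix_vector_mul_bounded_linear] Y Y1 Y2)
  moreover have "h sums (g 0 - 0)"
    unfolding h_eq by (rule telescope_sums'[OF g_lim])
  ultimately have main: "(of_real q - z) *s (x *s Y1)
      + ((mat z ** (A + B) - C - mat (of_real q)) *v Y
      + (C - mat z ** (A ** B)) *v (inverse x *s Y2)) = 0"
    using sums_unique2 g0 by fastforce
  define p where "p = z powr (- logq L q x)"
  have sol: "series_sol L q A B C x v z = p *s Y"
    by (simp add: series_sol_def p_def Y_def)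
  have "p = (z / of_real q) powr (- logq L q x) / x"
    using shift_powr_logq[OF q L x, of "z / of_real q"] q0 by (simp add: p_def)
  then have sol1: "series_sol L q A B C x v (z / of_real q) = p *s (x *s Y1)"
    using x by (simp add: series_sol_def Y1_def vector_smult_assoc)
  have sol2: "series_sol L q A B C x v (of_real q * z) = p *s (inverse x *s Y2)"
    using shift_powr_logq[OF q L x, of z]
    by (simp add: series_sol_def Y2_def vector_smult_assoc p_def divide_inverse)
  have "(of_real q - z) *s (p *s (x *s Y1)) + (mat z ** (A + B) - C - mat (of_real q)) *v (p *s Y)
      + (C - mat z ** (A ** B)) *v (p *s (inverse x *s Y2))
      = p *s ((of_real q - z) *s (x *s Y1)
      + ((mat z ** (A + B) - C - mat (of_real q)) *v Y
      + (C - mat z ** (A ** B)) *v (inverse x *s Y2)))"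
    by (simp add: vec_eq_iff vector_scalar_commute algebra_simps)
  also have "\<dots> = 0" unfolding main by simp
  finally show "(of_real q - z) *s series_sol L q A B C x v (z / of_real q)
      + (mat z ** (A + B) - C - mat (of_real q)) *v series_sol L q A B C x v z
      + (C - mat z ** (A ** B)) *v series_sol L q A B C x v (of_real q * z) = 0"
    unfolding sol sol1 sol2 .
qed

section \<open>Linear independence\<close>

lemma series_sol_sum:
  "(\<Sum>i\<in>S. c i *s series_sol L q A B C x (u i) z) = series_sol L q A B C x (\<Sum>i\<in>S. c i *s u i) z"
  unfolding series_sol_def
  by (simp add: vec.linear_sum[OF matrix_vector_mul_linear_gen] vec.scale_sum_right
      vector_scalar_commute vector_smult_assoc mult_ac)

text \<open>Along the points \<open>z q^(-n)\<close> the power of \<open>z\<close> contributes \<open>x^n\<close> and the series becomes a power series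
  in \<open>q^n\<close>, as in the hypotheses of \<open>leading_coeffs_zero\<close>.\<close>

lemma series_sol_at_qpower:
  fixes A B C :: "complex^'n^'n"
  assumes q: "0 < q" "q < 1" and L: "is_logarithm L" and x: "x \<noteq> 0"
    and dom: "z / of_real q ^ n \<in> series_dom q A B C x"
  shows "series_sol L q A B C x v (z / of_real q ^ n) $ j
    = x ^ n * (\<Sum>k. z powr (- logq L q x) * (Theta_term (of_real q * x) B A C q (of_real q / z) k *v v) $ j
        * of_real (q ^ n) ^ k)"
proof -
  have q0: "(of_real q :: complex) \<noteq> 0" using q by simp
  have powr: "(z / of_real q ^ n) powr (- logq L q x) = x ^ n * z powr (- logq L q x)"
  proof (induction n)
    case (Suc n)
    have "(z / of_real q ^ n) powr (- logq L q x)
        = (z / of_real q ^ Suc n) powr (- logq L q x) / x"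
      using shift_powr_logq[OF q L x, of "z / of_real q ^ Suc n"] q0 by simp
    then show ?case using Suc x by (simp add: field_simps)
  qed simp
  have "of_real q / (z / of_real q ^ n) = of_real q ^ n * (of_real q / z)" by simp
  then have terms: "Theta_term (of_real q * x) B A C q (of_real q / (z / of_real q ^ n)) k *v v
      = (of_real q ^ n) ^ k *s (Theta_term (of_real q * x) B A C q (of_real q / z) k *v v)" for k
    by (simp only: Theta_term_shift)
  have "(\<lambda>k. x ^ n * z powr (- logq L q x) *
        (Theta_term (of_real q * x) B A C q (of_real q / (z / of_real q ^ n)) k *v v) $ j)
      sums (x ^ n * z powr (- logq L q x) * (Theta (of_real q * x) B A C q (of_real q / (z / of_real q ^ n)) *v v) $ j)"
    by (intro sums_mult bounded_linear.sums[OF bounded_linear_vec_nth] Theta_mult_vector_sums dom)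
  then have "(\<lambda>k. x ^ n * (z powr (- logq L q x)
        * (Theta_term (of_real q * x) B A C q (of_real q / z) k *v v) $ j * of_real (q ^ n) ^ k))
      sums (series_sol L q A B C x v (z / of_real q ^ n) $ j)"
    unfolding terms series_sol_def powr by (simp add: mult_ac)
  then have "(\<lambda>k. z powr (- logq L q x)
        * (Theta_term (of_real q * x) B A C q (of_real q / z) k *v v) $ j * of_real (q ^ n) ^ k)
      sums (series_sol L q A B C x v (z / of_real q ^ n) $ j / x ^ n)"
    using sums_divide[where c = "x ^ n"] x by fastforce
  then show ?thesis using x by (simp add: sums_iff)
qed

text \<open>Solutions with different exponents are separated by their growth and rotation along \<open>z q^(-n)\<close>;
  the coefficients of order zero are the components of the leading vectors, up to the
  nonzero power of \<open>z\<close>.\<close>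

lemma series_sols_distinct_exponents:
  fixes A B C :: "complex^'n^'n"
  assumes q: "0 < q" "q < 1" and L: "is_logarithm L"
    and inv: "invertible A" "invertible B" and X: "finite X" "0 \<notin> X"
    and def: "\<And>x. x \<in> X \<Longrightarrow> qbracket_defined B A (of_real q * x) q"
    and sep: "\<And>x y k. x \<in> X \<Longrightarrow> y \<in> X \<Longrightarrow> x \<noteq> y * of_real q ^ Suc k"
    and zero: "\<forall>\<^sub>F z in at_infinity. (\<Sum>x\<in>X. series_sol L q A B C x (V x) z) = 0"
    and x: "x \<in> X"
  shows "V x = 0"
proof -
  define P where "P z \<longleftrightarrow> (\<forall>x\<in>X. z \<in> series_dom q A B C x \<and>
      (\<forall>v. summable (\<lambda>n. norm (Theta_term (of_real q * x) B A C q (of_real q / z) n *v v))))" for z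
  have "\<forall>\<^sub>F z in at_infinity. P z"
    unfolding P_def
    by (intro eventually_ball_finite X ballI eventually_conj eventually_in_series_dom
        eventually_Theta_terms_abs_summable q inv def)
  from eventually_conj[OF this zero] obtain b where
    b: "\<And>z. b \<le> norm z \<Longrightarrow> P z"
       "\<And>z. b \<le> norm z \<Longrightarrow> (\<Sum>x\<in>X. series_sol L q A B C x (V x) z) = 0"
    unfolding eventually_at_infinity by auto
  define z :: complex where "z = of_real (max b 1)"
  have z: "z \<noteq> 0" "b \<le> norm z" by (auto simp: z_def)
  have zn: "b \<le> norm (z / of_real q ^ n)" for n
  proof -
    have "norm z * q ^ n \<le> norm z"
      using q by (intro mult_left_le) (auto simp: power_le_one)
    then have "norm z \<le> norm z / q ^ n" using q by (simp add: pos_le_divide_eq)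
    also have "\<dots> = norm (z / of_real q ^ n)" using q by (simp add: norm_divide norm_power)
    finally show ?thesis using z(2) by linarith
  qed
  show ?thesis
  proof (subst vec_eq_iff, intro allI)
    fix j
    define d where "d x k = z powr (- logq L q x)
      * (Theta_term (of_real q * x) B A C q (of_real q / z) k *v V x) $ j" for x k
    have "d x 0 = 0"
    proof (rule leading_coeffs_zero[OF q X sep _ _ x])
      show "summable (\<lambda>k. norm (d y k))" if "y \<in> X" for y
      proof (rule summable_comparison_test'[of _ 0])
        show "summable (\<lambda>k. norm (z powr (- logq L q y))
            * norm (Theta_term (of_real q * y) B A C q (of_real q / z) k *v V y))"
          using b(1)[OF z(2)] that by (intro summable_mult) (simp add: P_def)
        show "norm (norm (d y k)) \<le> norm (z powr (- logq L q y))
            * norm (Theta_term (of_real q * y) B A C q (of_real q / z) k *v V y)" for k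
          by (simp add: d_def norm_mult mult_left_mono Finite_Cartesian_Product.norm_nth_le)
      qed
      show "(\<Sum>y\<in>X. y ^ n * (\<Sum>k. d y k * of_real (q ^ n) ^ k)) = 0" for n
      proof -
        have "(\<Sum>y\<in>X. y ^ n * (\<Sum>k. d y k * of_real (q ^ n) ^ k))
            = (\<Sum>y\<in>X. series_sol L q A B C y (V y) (z / of_real q ^ n) $ j)"
        proof (rule sum.cong[OF refl])
          fix y assume y: "y \<in> X"
          have "y \<noteq> 0" using X y by auto
          moreover have "z / of_real q ^ n \<in> series_dom q A B C y"
            using b(1)[OF zn] y by (simp add: P_def)
          ultimately have "series_sol L q A B C y (V y) (z / of_real q ^ n) $ j
              = y ^ n * (\<Sum>k. d y k * of_real (q ^ n) ^ k)"
            unfolding d_def by (rule series_sol_at_qpower[OF q L])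
          then show "y ^ n * (\<Sum>k. d y k * of_real (q ^ n) ^ k)
              = series_sol L q A B C y (V y) (z / of_real q ^ n) $ j" by (rule sym)
        qed
        also have "\<dots> = (\<Sum>y\<in>X. series_sol L q A B C y (V y) (z / of_real q ^ n)) $ j"
          by (simp add: sum_component)
        finally show ?thesis by (simp add: b(2)[OF zn])
      qed
    qed
    then show "V x $ j = 0 $ j" using z(1) by (simp add: d_def Theta_term_0)
  qed
qed

text \<open>Eigenvalues may be repeated. For equal \<open>e i\<close> the factors \<open>z powr _\<close> and \<open>Theta\<close> agree, so the
  solutions add up to the one whose leading vector is the combination of the vectors \<open>u i\<close>.\<close>

lemma lin_indep_series_sols:
  fixes A B C :: "complex^'n^'n" and e :: "'i::finite \<Rightarrow> complex"
  assumes q: "0 < q" "q < 1" and L: "is_logarithm L"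
    and inv: "invertible A" "invertible B" and e: "\<And>i. e i \<noteq> 0"
    and def: "\<And>i. qbracket_defined B A (of_real q * e i) q"
    and sep: "\<And>i j k. e i \<noteq> e j * of_real q ^ Suc k"
    and indep: "\<And>c i. (\<Sum>j | e j = e i. c j *s u j) = 0 \<Longrightarrow> c i = 0"
  shows "lin_indep_at_infinity (\<lambda>i. series_sol L q A B C (e i) (u i))"
  unfolding lin_indep_at_infinity_def
proof (intro allI impI)
  fix c :: "'i \<Rightarrow> complex" and i
  assume zero: "\<forall>\<^sub>F z in at_infinity. (\<Sum>i\<in>UNIV. c i *s series_sol L q A B C (e i) (u i) z) = 0"
  define V where "V x = (\<Sum>j | e j = x. c j *s u j)" for x
  have "(\<Sum>i\<in>UNIV. c i *s series_sol L q A B C (e i) (u i) z)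
      = (\<Sum>x\<in>range e. series_sol L q A B C x (V x) z)" for z
  proof -
    have "(\<Sum>i\<in>UNIV. c i *s series_sol L q A B C (e i) (u i) z)
        = (\<Sum>x\<in>range e. \<Sum>i | i \<in> UNIV \<and> e i = x. c i *s series_sol L q A B C (e i) (u i) z)"
      by (rule sum.group[symmetric]) auto
    also have "\<dots> = (\<Sum>x\<in>range e. series_sol L q A B C x (V x) z)"
      unfolding V_def series_sol_sum[symmetric] by (intro sum.cong) auto
    finally show ?thesis .
  qed
  then have "\<forall>\<^sub>F z in at_infinity. (\<Sum>x\<in>range e. series_sol L q A B C x (V x) z) = 0"
    using zero by simp
  then have "V (e i) = 0"
    using e def sep by (intro series_sols_distinct_exponents[OF q L inv, of "range e"]) auto
  then show "c i = 0" using indep by (simp add: V_def)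
qed

lemma eigenbasis_sum_zeroD:
  assumes "eigenbasis M m v" and "(\<Sum>i\<in>S. c i *s v i) = 0" and "i \<in> S"
  shows "c i = 0"
proof -
  have v: "inj v" "vec.independent (range v)" using assms(1) by (auto simp: eigenbasis_def)
  have "(\<Sum>w\<in>v ` S. c (inv v w) *s w) = 0"
    using assms(2) v(1) by (simp add: sum.reindex inj_on_subset[OF v(1)])
  then have "c (inv v (v i)) = 0"
    using assms(3) by (intro vec.independentD[OF v(2), of "v ` S" "\<lambda>w. c (inv v w)"]) auto
  then show ?thesis using v(1) by simp
qed

theorem theorem8p3:
  fixes q :: real
    and A B C :: "complex^'n^'n"
    and a b :: "'n \<Rightarrow> complex"
    and fA fB :: "'n \<Rightarrow> complex^'n"
    and L :: "complex \<Rightarrow> complex"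
  assumes "0 < q" and "q < 1"
    and "is_logarithm L"
    and "eigenbasis A a fA" and "spectrum A = range a"
    and "eigenbasis B b fB" and "spectrum B = range b"
    and "0 \<notin> spectrum A" and "0 \<notin> spectrum B"
    and "spectrum A \<inter> spectrum B = {}"
    and "spectrum A \<inter> qshifts q (spectrum B) = {}"
    and "spectrum B \<inter> qshifts q (spectrum B) = {}"
    and "\<And>i. qbracket_defined B A (of_real q * b i) q"
    and "\<And>i. qbracket_defined B A (of_real q * a i) q"
  defines "solB \<equiv> \<lambda>i. series_sol L q A B C (b i) (fB i)"
    and "solA \<equiv> \<lambda>i. series_sol L q A B C (a i) (matrix_inv (mat (a i) - B) *v fA i)"
  shows "(\<forall>i. (\<forall>\<^sub>F z in at_infinity. z \<in> series_dom q A B C (b i)) \<and>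
              solves_qhyp_on q A B C (series_dom q A B C (b i)) (solB i)) \<and>
         (\<forall>i. (\<forall>\<^sub>F z in at_infinity. z \<in> series_dom q A B C (a i)) \<and>
              solves_qhyp_on q A B C (series_dom q A B C (a i)) (solA i)) \<and>
         lin_indep_at_infinity (case_sum solB solA)"
proof -
  note q = assms(1,2) and L = assms(3) and specA = assms(5) and specB = assms(7)
    and defB = assms(13) and defA = assms(14)
  have inv: "invertible A" "invertible B"
    using assms(8,9) by (simp_all add: invertible_iff_0_notin_spectrum)
  have a0: "a i \<noteq> 0" and b0: "b i \<noteq> 0" for i
    using assms(8,9) specA specB by (metis rangeI)+
  have ab: "a i \<noteq> b j" for i j
    using assms(10) specA specB by auto
  have eigA: "A *v fA i = a i *s fA i" and eigB: "B *v fB i = b i *s fB i" for i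
    using assms(4,6) by (auto simp: eigenbasis_def)
  define w where "w i = matrix_inv (mat (a i) - B) *v fA i" for i
  have w: "(mat (a i) - B) *v w i = fA i" for i
  proof -
    have "invertible (mat (a i) - B)" using ab specB by (auto simp: invertible_mat_diff_iff)
    then show ?thesis by (simp add: w_def matrix_inv_cancel(1))
  qed
  have indB: "(A - mat (b i)) *v ((B - mat (b i)) *v fB i) = 0" for i
    by (simp add: matrix_vector_mult_diff_rdistrib mat_vector_mult eigB)
  have indA: "(A - mat (a i)) *v ((B - mat (a i)) *v w i) = 0" for i
  proof -
    have "(B - mat (a i)) *v w i = - fA i"
      using w[of i] by (simp add: matrix_vector_mult_diff_rdistrib algebra_simps)
    also have "(A - mat (a i)) *v - fA i = - ((A - mat (a i)) *v fA i)"
      by (rule vec.linear_neg[OF matrix_vector_mul_linear_gen])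
    finally show ?thesis
      by (simp add: matrix_vector_mult_diff_rdistrib mat_vector_mult eigA)
  qed
  have "lin_indep_at_infinity (\<lambda>i. series_sol L q A B C (case_sum b a i) (case_sum fB w i))"
  proof (rule lin_indep_series_sols[OF q L inv])
    fix i :: "'n + 'n"
    show "case_sum b a i \<noteq> 0" using a0 b0 by (cases i) auto
    show def: "qbracket_defined B A (of_real q * case_sum b a i) q" for i
      using defA defB by (cases i) auto
    \<comment> \<open>If \<open>y\<close> is an eigenvalue of \<open>A\<close> or \<open>B\<close>, then \<open>y q^(1+k)\<close> is not, because \<open>A - y q^(1+k)\<close>
          and \<open>B - y q^(1+k)\<close> are inverted in the series for \<open>y\<close>.\<close>
    show "case_sum b a i \<noteq> case_sum b a j * of_real q ^ Suc k" for j k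
    proof -
      have "invertible (B - mat (case_sum b a j * of_real q ^ Suc k))"
        "invertible (A - mat (case_sum b a j * of_real q ^ Suc k))"
        using def[of j] by (auto simp: qbracket_defined_def mult_ac)
      then have "case_sum b a j * of_real q ^ Suc k \<notin> range a \<union> range b"
        using specA specB by (simp add: invertible_diff_mat_iff)
      moreover have "case_sum b a i \<in> range a \<union> range b" by (cases i) auto
      ultimately show ?thesis by metis
    qed
    fix c :: "'n + 'n \<Rightarrow> complex"
    assume rel: "(\<Sum>j | case_sum b a j = case_sum b a i. c j *s case_sum fB w j) = 0"
    show "c i = 0"
    proof (cases i)
      case (Inl k)
      have "{j. case_sum b a j = b k} = Inl ` {j. b j = b k}" (is "?L = ?R")
      proof (rule set_eqI)
        show "j \<in> ?L \<longleftrightarrow> j \<in> ?R" for j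
          using ab ab[symmetric] by (cases j) auto
      qed
      then have "(\<Sum>j | b j = b k. c (Inl j) *s fB j) = 0"
        using rel Inl by (simp add: sum.reindex)
      then show ?thesis using eigenbasis_sum_zeroD[OF assms(6)] Inl by fastforce
    next
      case (Inr k)
      have "{j. case_sum b a j = a k} = Inr ` {j. a j = a k}" (is "?L = ?R")
      proof (rule set_eqI)
        show "j \<in> ?L \<longleftrightarrow> j \<in> ?R" for j
          using ab ab[symmetric] by (cases j) auto
      qed
      then have "(\<Sum>j | a j = a k. c (Inr j) *s w j) = 0"
        using rel Inr by (simp add: sum.reindex)
      \<comment> \<open>Applying \<open>a k - B\<close> turns the vectors \<open>w j\<close> back into eigenvectors of \<open>A\<close>.\<close>
      then have "(mat (a k) - B) *v (\<Sum>j | a j = a k. c (Inr j) *s w j) = 0" by simp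
      also have "(mat (a k) - B) *v (\<Sum>j | a j = a k. c (Inr j) *s w j)
          = (\<Sum>j | a j = a k. c (Inr j) *s fA j)"
      proof -
        have "(mat (a k) - B) *v w j = fA j" if "a j = a k" for j
          using w[of j] that by simp
        then show ?thesis
          by (simp add: vec.linear_sum[OF matrix_vector_mul_linear_gen] vector_scalar_commute)
      qed
      finally have "(\<Sum>j | a j = a k. c (Inr j) *s fA j) = 0" .
      then show ?thesis using eigenbasis_sum_zeroD[OF assms(4)] Inr by fastforce
    qed
  qed
  also have "(\<lambda>i. series_sol L q A B C (case_sum b a i) (case_sum fB w i)) = case_sum solB solA"
    by (auto simp: fun_eq_iff solA_def solB_def w_def split: sum.splits)
  finally have indep: "lin_indep_at_infinity (case_sum solB solA)" .
  show ?thesis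
    using indep eventually_in_series_dom[OF q inv defB] eventually_in_series_dom[OF q inv defA]
      series_sol_solves[OF q L b0 defB indB] series_sol_solves[OF q L a0 defA indA]
    by (simp add: solA_def solB_def w_def)
qed

end
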